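(* Consider a radial flow network with operational tree $\mathcal{T}$, strictly increasing flow functions and independent injections at non-reference nodes, each having a probability density, such that all nodal potentials have finite variance. Let $\phi_{uv}$ denote the variance of the potential difference $\pi_u-\pi_v$. Let $a,b,c$ be three pairwise distinct nodes such that the path from $a$ to $c$ in $\mathcal{T}$ passes through $b$. Then $\phi_{ab}<\phi_{ac}$.
   Context: Radial flow network: $\mathcal{T}$ is a finite tree with edge set $\mathcal{E}_{\mathcal{T}}$ (the operational edges). One node is distinguished as the reference node. All edges of $\mathcal{T}$ are directed towards the reference node: an edge is written $(ab)$ with $b$ the parent of $a$, i.e. $b$ is the neighbour of $a$ on the unique path in $\mathcal{T}$ from $a$ to the reference node. Injections: each non-reference node $a$ has a real random injection $P_a$; the injections at non-reference nodes are mutually independent and each has a probability density function. The injection at the reference node is minus the sum of all the others. Flows: $f_{ab}$ is the flow from $a$ to $b$ on the edge $(ab)$, with $f_{ba}=-f_{ab}$. Flow is conserved at every node: $P_a=\sum_{b:\,a,b \text{ adjacent in } \mathcal{T}} f_{ab}$. These equations determine the flows from the injections. Potentials: every edge $(ab)$ (with $b$ the parent of $a$) has a strictly increasing flow function $g_{ab}:\mathbb{R}\to\mathbb{R}$, possibly nonlinear and possibly different for each edge, and the nodal potentials $\pi_a$ satisfy $\pi_a-\pi_b=g_{ab}(f_{ab})$. The potential at the reference node is a fixed constant (potentials are measured relative to it). All potentials are assumed to have finite variance, and $\phi_{uv}=\mathbb{E}\big[\big(\pi_u-\pi_v-\mathbb{E}[\pi_u-\pi_v]\big)^2\big]$ for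 any two nodes $u,v$. *)

theory Defs
  imports "HOL-Probability.Probability" "Graph_Theory.Digraph_Component"
begin

text \<open>
  An undirected graph is a symmetric digraph (locale \<^locale>\<open>graph\<close>), so every edge yields a
  pair of opposite arcs, which is a directed cycle of length 2. For this reason
  \<^const>\<open>forest\<close> and \<^const>\<open>tree\<close> are unusable here: they would
  exclude all edges. A cycle of the underlying undirected graph is a directed cycle of
  length at least 3.
\<close>

locale radial_tree = graph T for T :: "('v, 'e) pre_digraph" +
  fixes r :: 'v
  assumes connected_T: "Digraph_Component.connected T"
    and no_undirected_cycle: "\<not> (\<exists>p. cycle p \<and> 3 \<le> length p)"
    and reference_node: "r \<in> verts T"

text \<open>
  Simple paths between two nodes of a tree are unique, so the existential quantifier
  below refers to the path from \<open>u\<close> to \<open>v\<close>.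
\<close>

definition (in pre_digraph) path_through :: "'a \<Rightarrow> 'a \<Rightarrow> 'a \<Rightarrow> bool" where
  "path_through u w v \<longleftrightarrow> (\<exists>p. apath u p v \<and> w \<in> set (awalk_verts u p))"

definition (in radial_tree) is_parent :: "'v \<Rightarrow> 'v \<Rightarrow> bool" where
  "is_parent b a \<longleftrightarrow> dominates T a b \<and> path_through a b r"

text \<open>
  \<open>f a b\<close> is the flow from \<open>a\<close> to \<open>b\<close> and is constrained only for adjacent nodes; \<open>g a b\<close> is
  the flow function of the edge \<open>(ab)\<close> and is constrained only when \<open>b\<close> is the parent of \<open>a\<close>.
\<close>

locale radial_flow_network = radial_tree T r + prob_space M
  for T :: "('v, 'e) pre_digraph" and r :: 'v and M :: "'w measure" +
  fixes P :: "'v \<Rightarrow> 'w \<Rightarrow> real"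
    and f :: "'v \<Rightarrow> 'v \<Rightarrow> 'w \<Rightarrow> real"
    and g :: "'v \<Rightarrow> 'v \<Rightarrow> real \<Rightarrow> real"
    and \<pi> :: "'v \<Rightarrow> 'w \<Rightarrow> real"
  assumes injections_indep: "indep_vars (\<lambda>_. borel) P (verts T - {r})"
    and injections_density:
      "\<And>a. a \<in> verts T - {r} \<Longrightarrow> \<exists>D. distributed M lborel (P a) D"
    and reference_injection:
      "\<And>\<omega>. \<omega> \<in> space M \<Longrightarrow> P r \<omega> = - (\<Sum>a\<in>verts T - {r}. P a \<omega>)"
    and flow_antisym:
      "\<And>a b \<omega>. dominates T a b \<Longrightarrow> \<omega> \<in> space M \<Longrightarrow> f b a \<omega> = - f a b \<omega>"
    and flow_conservation:
      "\<And>a \<omega>. a \<in> verts T \<Longrightarrow> \<omega> \<in> space M \<Longrightarrow> P a \<omega> = (\<Sum>b | dominates T a b. f a b \<omega>)"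
    and flow_function_strict_mono:
      "\<And>a b. is_parent b a \<Longrightarrow> strict_mono (g a b)"
    and potential_difference:
      "\<And>a b \<omega>. is_parent b a \<Longrightarrow> \<omega> \<in> space M \<Longrightarrow> \<pi> a \<omega> - \<pi> b \<omega> = g a b (f a b \<omega>)"
    and reference_potential: "\<exists>c. \<forall>\<omega>\<in>space M. \<pi> r \<omega> = c"
    and potential_integrable: "\<And>a. a \<in> verts T \<Longrightarrow> integrable M (\<pi> a)"
    and potential_finite_variance:
      "\<And>a. a \<in> verts T \<Longrightarrow> integrable M (\<lambda>\<omega>. (\<pi> a \<omega> - expectation (\<pi> a))\<^sup>2)"

definition potential_diff_variance :: "'w measure \<Rightarrow> ('v \<Rightarrow> 'w \<Rightarrow> real) \<Rightarrow> 'v \<Rightarrow> 'v \<Rightarrow> real" where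
  "potential_diff_variance M \<pi> u v = prob_space.variance M (\<lambda>\<omega>. \<pi> u \<omega> - \<pi> v \<omega>)"

end

theory Submission
  imports Defs
begin

text \<open>
  The path from \<open>a\<close> to \<open>c\<close> splits at \<open>b\<close>, and \<open>\<pi> a - \<pi> c\<close> is the sum of the two differences
  \<open>X = \<pi> a - \<pi> b\<close> and \<open>Y = \<pi> b - \<pi> c\<close>. Its variance is the variance of \<open>X\<close>, plus the variance of
  \<open>Y\<close>, plus twice their covariance. So it suffices that the covariance is nonnegative and that \<open>Y\<close>
  has positive variance.

  Both differences telescope along the path, and covariance is bilinear. So the covariance is a sum
  over pairs of arcs, one from each half of the path. Conservation expresses the flow on the arc from
  \<open>x\<close> to \<open>y\<close> as the total injection on the side of \<open>x\<close>, the component of \<open>x\<close> once that edge is removed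
  (\<open>flow_equals_injection_of_side\<close>), and the potential difference across the arc is an increasing
  function of this flow. The sides of two arcs on a simple path are nested (\<open>side_mono_along_path\<close>).
  Replacing a side that contains the reference node, the root of the tree, by its complement turns
  the sum into its negative, because all injections add up to zero. In this way
  one sees that the two flows are either independent or of the form \<open>S\<close> and \<open>S + R\<close> with \<open>S\<close> and \<open>R\<close>
  independent. Increasing functions of such variables have nonnegative covariance
  (\<open>covariance_nonneg_common_variable\<close>).

  For the strict inequality, the variance of \<open>Y\<close> is, again by nonnegative covariance, at least that of
  the potential difference across a single arc. The flow there is up to sign a nonempty sum of
  independent injections with densities. It has a density, so an injective function of it is not
  almost surely constant.
\<close>

section \<open>Covariance of monotone functions of independent variables\<close>

context prob_space
begin

definition square_integrable :: "('a \<Rightarrow> real) \<Rightarrow> bool" where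
  "square_integrable X \<longleftrightarrow> random_variable borel X \<and> integrable M (\<lambda>\<omega>. (X \<omega>)\<^sup>2)"

text \<open>
  Only meaningful for square integrable arguments, where it agrees with the centred form.
\<close>

definition covariance :: "('a \<Rightarrow> real) \<Rightarrow> ('a \<Rightarrow> real) \<Rightarrow> real" where
  "covariance X Y = expectation (\<lambda>\<omega>. X \<omega> * Y \<omega>) - expectation X * expectation Y"

lemma integrable_mult_square_integrable:
  assumes "square_integrable X" "square_integrable Y"
  shows "integrable M (\<lambda>\<omega>. X \<omega> * Y \<omega>)"
proof (rule Bochner_Integration.integrable_bound)
  show "integrable M (\<lambda>\<omega>. (X \<omega>)\<^sup>2 + (Y \<omega>)\<^sup>2)"
    using assms by (simp add: square_integrable_def)
  show "(\<lambda>\<omega>. X \<omega> * Y \<omega>) \<in> borel_measurable M"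
    using assms by (auto simp: square_integrable_def)
  have "\<bar>x * y\<bar> \<le> x\<^sup>2 + y\<^sup>2" for x y :: real
  proof -
    have "2 * (\<bar>x\<bar> * \<bar>y\<bar>) \<le> x\<^sup>2 + y\<^sup>2"
      using sum_squares_bound[of "\<bar>x\<bar>" "\<bar>y\<bar>"] by (simp add: mult.assoc)
    moreover have "0 \<le> \<bar>x\<bar> * \<bar>y\<bar>" by simp
    ultimately show ?thesis unfolding abs_mult by linarith
  qed
  then show "AE \<omega> in M. norm (X \<omega> * Y \<omega>) \<le> norm ((X \<omega>)\<^sup>2 + (Y \<omega>)\<^sup>2)"
    by simp
qed

lemma integrable_square_integrable:
  "square_integrable X \<Longrightarrow> integrable M X"
  using square_integrable_imp_integrable by (auto simp: square_integrable_def)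

lemma square_integrable_add:
  assumes "square_integrable X" "square_integrable Y"
  shows "square_integrable (\<lambda>\<omega>. X \<omega> + Y \<omega>)"
  using assms integrable_mult_square_integrable[OF assms]
  by (auto simp: square_integrable_def power2_sum mult.assoc)

lemma square_integrable_diff:
  assumes "square_integrable X" "square_integrable Y"
  shows "square_integrable (\<lambda>\<omega>. X \<omega> - Y \<omega>)"
  using assms integrable_mult_square_integrable[OF assms]
  by (auto simp: square_integrable_def power2_diff mult.assoc)

lemma square_integrable_finite_variance:
  assumes "integrable M X" "integrable M (\<lambda>\<omega>. (X \<omega> - m)\<^sup>2)"
  shows "square_integrable X"
proof -
  have "(\<lambda>\<omega>. (X \<omega>)\<^sup>2) = (\<lambda>\<omega>. (X \<omega> - m)\<^sup>2 + 2 * m * X \<omega> - m\<^sup>2)"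
    by (simp add: fun_eq_iff power2_diff)
  then show ?thesis
    using assms by (simp add: square_integrable_def)
qed

lemma square_integrable_cong:
  assumes "\<And>\<omega>. \<omega> \<in> space M \<Longrightarrow> X \<omega> = Y \<omega>"
  shows "square_integrable X \<longleftrightarrow> square_integrable Y"
  unfolding square_integrable_def
  by (intro conj_cong measurable_cong Bochner_Integration.integrable_cong) (simp_all add: assms)

lemma covariance_cong:
  assumes "\<And>\<omega>. \<omega> \<in> space M \<Longrightarrow> X \<omega> = X' \<omega>" "\<And>\<omega>. \<omega> \<in> space M \<Longrightarrow> Y \<omega> = Y' \<omega>"
  shows "covariance X Y = covariance X' Y'"
proof -
  have "expectation X = expectation X'" "expectation Y = expectation Y'"
       "expectation (\<lambda>\<omega>. X \<omega> * Y \<omega>) = expectation (\<lambda>\<omega>. X' \<omega> * Y' \<omega>)"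
    by (intro Bochner_Integration.integral_cong; simp add: assms)+
  then show ?thesis by (simp add: covariance_def)
qed

lemma covariance_commute: "covariance X Y = covariance Y X"
  by (simp add: covariance_def mult.commute)

lemma covariance_add_left:
  assumes "square_integrable X" "square_integrable Y" "square_integrable Z"
  shows "covariance (\<lambda>\<omega>. X \<omega> + Y \<omega>) Z = covariance X Z + covariance Y Z"
  using assms
  by (simp add: covariance_def distrib_right integrable_mult_square_integrable
      integrable_square_integrable)

lemma variance_add:
  assumes X: "square_integrable X" and Y: "square_integrable Y"
  shows "variance (\<lambda>\<omega>. X \<omega> + Y \<omega>) = variance X + variance Y + 2 * covariance X Y"
proof -
  note ints = integrable_square_integrable[OF X] integrable_square_integrable[OF Y]
    integrable_mult_square_integrable[OF X Y]
  have sq: "integrable M (\<lambda>\<omega>. (X \<omega>)\<^sup>2)" "integrable M (\<lambda>\<omega>. (Y \<omega>)\<^sup>2)"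
    using X Y by (simp_all add: square_integrable_def)
  have sum: "variance (\<lambda>\<omega>. X \<omega> + Y \<omega>)
      = expectation (\<lambda>\<omega>. (X \<omega> + Y \<omega>)\<^sup>2) - (expectation (\<lambda>\<omega>. X \<omega> + Y \<omega>))\<^sup>2"
    using square_integrable_add[OF X Y]
    by (intro variance_eq[OF integrable_square_integrable]) (simp_all only: square_integrable_def)
  have mean: "expectation (\<lambda>\<omega>. X \<omega> + Y \<omega>) = expectation X + expectation Y"
    using ints by simp
  have square: "expectation (\<lambda>\<omega>. (X \<omega> + Y \<omega>)\<^sup>2)
      = expectation (\<lambda>\<omega>. (X \<omega>)\<^sup>2) + expectation (\<lambda>\<omega>. (Y \<omega>)\<^sup>2) + 2 * expectation (\<lambda>\<omega>. X \<omega> * Y \<omega>)"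
    using ints sq by (simp add: power2_sum mult.assoc)
  show ?thesis
    unfolding sum unfolding mean square covariance_def
      variance_eq[OF ints(1) sq(1)] variance_eq[OF ints(2) sq(2)]
    by (simp add: power2_sum algebra_simps)
qed

text \<open>
  Chebyshev's inequality. If \<open>y\<close> is an independent copy of \<open>x\<close>, the expectation of the nonnegative
  quantity \<open>(\<phi> x - \<phi> y) * (\<psi> x - \<psi> y)\<close> is twice the covariance. Averaging first over \<open>x\<close> with
  \<open>y\<close> held fixed and then over \<open>y\<close> avoids the product measure.
\<close>

lemma expectation_mult_ge_if_comonotone:
  fixes \<phi> \<psi> :: "'a \<Rightarrow> real"
  assumes int: "integrable M \<phi>" "integrable M \<psi>" "integrable M (\<lambda>x. \<phi> x * \<psi> x)"
    and comonotone: "\<And>x y. 0 \<le> (\<phi> x - \<phi> y) * (\<psi> x - \<psi> y)"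
  shows "expectation \<phi> * expectation \<psi> \<le> expectation (\<lambda>x. \<phi> x * \<psi> x)"
proof -
  let ?E = "expectation (\<lambda>x. \<phi> x * \<psi> x)"
  have inner: "0 \<le> ?E - \<phi> y * expectation \<psi> - \<psi> y * expectation \<phi> + \<phi> y * \<psi> y" for y
  proof -
    have "0 \<le> expectation (\<lambda>x. (\<phi> x - \<phi> y) * (\<psi> x - \<psi> y))"
      by (intro integral_nonneg_AE) (simp add: comonotone)
    also have "\<dots> = expectation (\<lambda>x. \<phi> x * \<psi> x - \<phi> y * \<psi> x - \<psi> y * \<phi> x + \<phi> y * \<psi> y)"
      by (simp add: algebra_simps)
    also have "\<dots> = ?E - \<phi> y * expectation \<psi> - \<psi> y * expectation \<phi> + \<phi> y * \<psi> y"
      using int by (simp add: prob_space)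
    finally show ?thesis .
  qed
  have "0 \<le> expectation (\<lambda>y. ?E - \<phi> y * expectation \<psi> - \<psi> y * expectation \<phi> + \<phi> y * \<psi> y)"
    by (intro integral_nonneg_AE) (simp add: inner)
  also have "\<dots> = 2 * (?E - expectation \<phi> * expectation \<psi>)"
    using int by (simp add: prob_space)
  finally show ?thesis by simp
qed

text \<open>
  A two-variable case of the Harris inequality. Freezing the independent variable \<open>R\<close> at a value
  \<open>\<rho>\<close> leaves two increasing functions of the single variable \<open>X\<close>, to which Chebyshev's inequality
  applies; Fubini's theorem then averages over \<open>\<rho>\<close>. Since \<open>h\<close> does not depend on \<open>\<rho>\<close>, the product
  of the two conditional expectations averages to the product of the expectations.
\<close>

lemma covariance_nonneg_common_variable:
  fixes X R :: "'a \<Rightarrow> real" and k :: "real \<Rightarrow> real \<Rightarrow> real"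
  assumes indep: "indep_var borel X borel R"
    and h: "mono h" and k: "\<And>\<rho>. mono (\<lambda>x. k x \<rho>)"
    and k_measurable: "case_prod k \<in> borel_measurable (borel \<Otimes>\<^sub>M borel)"
    and sq: "square_integrable (\<lambda>\<omega>. h (X \<omega>))" "square_integrable (\<lambda>\<omega>. k (X \<omega>) (R \<omega>))"
  shows "0 \<le> covariance (\<lambda>\<omega>. h (X \<omega>)) (\<lambda>\<omega>. k (X \<omega>) (R \<omega>))"
proof -
  let ?\<mu> = "distr M borel X" and ?\<nu> = "distr M borel R"
  have [measurable]: "X \<in> borel_measurable M" "R \<in> borel_measurable M"
    using indep by (auto dest: indep_var_rv1 indep_var_rv2)
  note [measurable] = borel_measurable_mono[OF h] k_measurable
  have joint: "?\<mu> \<Otimes>\<^sub>M ?\<nu> = distr M (borel \<Otimes>\<^sub>M borel) (\<lambda>\<omega>. (X \<omega>, R \<omega>))"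
    using indep unfolding indep_var_distribution_eq by (elim conjE)
  interpret \<mu>: prob_space ?\<mu> by (rule prob_space_distr) simp
  interpret \<nu>: prob_space ?\<nu> by (rule prob_space_distr) simp
  interpret \<mu>\<nu>: pair_prob_space ?\<mu> ?\<nu> ..
  have hk_measurable: "(\<lambda>(x, \<rho>). h x * k x \<rho>) \<in> borel_measurable (borel \<Otimes>\<^sub>M borel)"
    using k_measurable by (simp add: split_beta')
  have int_h: "integrable ?\<mu> h"
    using integrable_square_integrable[OF sq(1)] by (simp add: integrable_distr_eq)
  have int_k: "integrable (?\<mu> \<Otimes>\<^sub>M ?\<nu>) (\<lambda>(x, \<rho>). k x \<rho>)"
    unfolding joint using integrable_square_integrable[OF sq(2)] k_measurable
    by (subst integrable_distr_eq) simp_all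
  have int_hk: "integrable (?\<mu> \<Otimes>\<^sub>M ?\<nu>) (\<lambda>(x, \<rho>). h x * k x \<rho>)"
    unfolding joint using integrable_mult_square_integrable[OF sq] hk_measurable
    by (subst integrable_distr_eq) simp_all
  have "expectation (\<lambda>\<omega>. h (X \<omega>)) * expectation (\<lambda>\<omega>. k (X \<omega>) (R \<omega>))
      = (\<integral>x. h x \<partial>?\<mu>) * (\<integral>(x, \<rho>). k x \<rho> \<partial>(?\<mu> \<Otimes>\<^sub>M ?\<nu>))"
    unfolding joint using k_measurable by (simp add: integral_distr)
  also have "\<dots> = (\<integral>\<rho>. (\<integral>x. h x \<partial>?\<mu>) * (\<integral>x. k x \<rho> \<partial>?\<mu>) \<partial>?\<nu>)"
    using \<mu>\<nu>.integral_snd[OF int_k] by simp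
  also have "\<dots> \<le> (\<integral>\<rho>. (\<integral>x. h x * k x \<rho> \<partial>?\<mu>) \<partial>?\<nu>)"
  proof (rule integral_mono_AE)
    show "integrable ?\<nu> (\<lambda>\<rho>. (\<integral>x. h x \<partial>?\<mu>) * (\<integral>x. k x \<rho> \<partial>?\<mu>))"
      using \<mu>\<nu>.integrable_snd[OF int_k] by simp
    show "integrable ?\<nu> (\<lambda>\<rho>. \<integral>x. h x * k x \<rho> \<partial>?\<mu>)"
      using \<mu>\<nu>.integrable_snd[OF int_hk] by simp
    show "AE \<rho> in ?\<nu>. (\<integral>x. h x \<partial>?\<mu>) * (\<integral>x. k x \<rho> \<partial>?\<mu>) \<le> (\<integral>x. h x * k x \<rho> \<partial>?\<mu>)"
      using \<mu>\<nu>.AE_integrable_snd[OF int_k] \<mu>\<nu>.AE_integrable_snd[OF int_hk]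
    proof eventually_elim
      fix \<rho>
      assume "integrable ?\<mu> (\<lambda>x. k x \<rho>)" and "integrable ?\<mu> (\<lambda>x. h x * k x \<rho>)"
      moreover have "0 \<le> (h x - h y) * (k x \<rho> - k y \<rho>)" for x y
        using monoD[OF h, of x y] monoD[OF h, of y x] monoD[OF k, of x y \<rho>] monoD[OF k, of y x \<rho>]
        by (cases "x \<le> y") (auto intro: mult_nonneg_nonneg mult_nonpos_nonpos)
      ultimately show "(\<integral>x. h x \<partial>?\<mu>) * (\<integral>x. k x \<rho> \<partial>?\<mu>) \<le> (\<integral>x. h x * k x \<rho> \<partial>?\<mu>)"
        by (intro \<mu>.expectation_mult_ge_if_comonotone int_h)
    qed
  qed
  also have "\<dots> = expectation (\<lambda>\<omega>. h (X \<omega>) * k (X \<omega>) (R \<omega>))"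
    unfolding \<mu>\<nu>.integral_snd[OF int_hk] unfolding joint using hk_measurable by (simp add: integral_distr)
  finally show ?thesis by (simp add: covariance_def)
qed

lemma indep_var_sums:
  fixes X :: "'i \<Rightarrow> 'a \<Rightarrow> real"
  assumes "indep_vars (\<lambda>_. borel) X I" "A \<inter> B = {}" "A \<subseteq> I" "B \<subseteq> I"
  shows "indep_var borel (\<lambda>\<omega>. \<Sum>i\<in>A. X i \<omega>) borel (\<lambda>\<omega>. \<Sum>i\<in>B. X i \<omega>)"
proof -
  have "indep_var borel ((\<lambda>x. \<Sum>i\<in>A. x i) \<circ> (\<lambda>\<omega>. restrict (\<lambda>i. X i \<omega>) A))
      borel ((\<lambda>x. \<Sum>i\<in>B. x i) \<circ> (\<lambda>\<omega>. restrict (\<lambda>i. X i \<omega>) B))"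
    by (rule indep_var_compose[OF indep_var_restrict[OF assms]]) measurable
  then show ?thesis by (simp add: comp_def cong: sum.cong)
qed

lemma sum_has_density:
  fixes X :: "'i \<Rightarrow> 'a \<Rightarrow> real"
  assumes "finite A" "A \<noteq> {}" "indep_vars (\<lambda>_. borel) X A"
    and "\<And>i. i \<in> A \<Longrightarrow> \<exists>D. distributed M lborel (X i) D"
  shows "\<exists>D. distributed M lborel (\<lambda>\<omega>. \<Sum>i\<in>A. X i \<omega>) D"
  using assms
proof (induction A rule: finite_ne_induct)
  case (insert i A)
  obtain D where D: "distributed M lborel (\<lambda>\<omega>. \<Sum>i\<in>A. X i \<omega>) D"
    using insert.IH insert.prems indep_vars_subset[OF insert.prems(1), of A] by blast
  obtain D' where D': "distributed M lborel (X i) D'"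
    using insert.prems(2) by blast
  show ?case
    using distributed_convolution[OF indep_vars_sum[OF insert.hyps(1,3) insert.prems(1)] D' D]
      insert.hyps by auto
qed simp

text \<open>
  A set of Lebesgue measure zero, in particular a point, has probability zero.
\<close>

lemma density_not_AE_constant:
  fixes X :: "'a \<Rightarrow> real"
  assumes "distributed M lborel X D"
  shows "\<not> (AE \<omega> in M. X \<omega> = t)"
proof
  assume AE: "AE \<omega> in M. X \<omega> = t"
  have [measurable]: "X \<in> borel_measurable M"
    using distributed_measurable[OF assms] by simp
  have "emeasure M (X -` {t} \<inter> space M) = (\<integral>\<^sup>+x. D x * indicator {t} x \<partial>lborel)"
    by (rule distributed_emeasure[OF assms]) simp
  also have "\<dots> = (\<integral>\<^sup>+x. 0 \<partial>(lborel :: real measure))"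
    by (intro nn_integral_cong_AE AE_I[where N = "{t}"]) (auto simp: indicator_def)
  finally have "emeasure M {\<omega> \<in> space M. X \<omega> = t} = 0"
    by (simp add: vimage_def Int_def conj_commute)
  moreover have "emeasure M {\<omega> \<in> space M. X \<omega> = t} = 1"
    using AE by (intro emeasure_eq_1_AE) auto
  ultimately show False by simp
qed

text \<open>
  A random variable of variance zero is almost surely equal to its mean. An injective \<open>h\<close> transports
  this back to \<open>F\<close>, which has no atoms.
\<close>

lemma variance_pos_if_injective_image_of_density:
  fixes F :: "'a \<Rightarrow> real"
  assumes sq: "square_integrable (\<lambda>\<omega>. h (F \<omega>))" and h: "inj h"
    and F: "distributed M lborel F D"
  shows "0 < variance (\<lambda>\<omega>. h (F \<omega>))"
proof (rule ccontr)
  let ?m = "expectation (\<lambda>\<omega>. h (F \<omega>))"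
  assume "\<not> 0 < variance (\<lambda>\<omega>. h (F \<omega>))"
  then have 0: "variance (\<lambda>\<omega>. h (F \<omega>)) = 0"
    using variance_positive[of "\<lambda>\<omega>. h (F \<omega>)"] by simp
  have "square_integrable (\<lambda>\<omega>. ?m)"
    by (simp add: square_integrable_def)
  then have "integrable M (\<lambda>\<omega>. (h (F \<omega>) - ?m)\<^sup>2)"
    using square_integrable_diff[OF sq] by (simp add: square_integrable_def)
  then have const: "AE \<omega> in M. h (F \<omega>) = ?m"
    using 0 by (subst (asm) integral_nonneg_eq_0_iff_AE) simp_all
  then have "AE \<omega> in M. F \<omega> = the_inv h ?m"
    by eventually_elim (metis h the_inv_f_f)
  then show False
    using density_not_AE_constant[OF F] by simp
qed

end

section \<open>Sides of the edges of a tree\<close>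

context radial_tree
begin

text \<open>
  The component of \<open>x\<close> after the edge between \<open>x\<close> and \<open>y\<close> has been deleted. Both orientations of
  the edge have to be removed.
\<close>

definition side :: "'v \<Rightarrow> 'v \<Rightarrow> 'v set" where
  "side x y = (arcs_ends T - {(x, y), (y, x)})\<^sup>* `` {x}"

lemma dominates_sym: "dominates T x y \<Longrightarrow> dominates T y x"
  using arcs_ends_symmetric[OF sym_arcs] .

lemma self_in_side: "x \<in> side x y"
  by (simp add: side_def)

lemma side_subset_verts:
  assumes "x \<in> verts T"
  shows "side x y \<subseteq> verts T"
proof
  fix v
  assume "v \<in> side x y"
  then have "(x, v) \<in> (arcs_ends T - {(x, y), (y, x)})\<^sup>*"
    by (simp add: side_def)
  then show "v \<in> verts T"
    using assms by induction (auto dest: adj_in_verts)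
qed

lemma side_step:
  assumes "v \<in> side x y" "dominates T v w" "(v, w) \<noteq> (x, y)" "(v, w) \<noteq> (y, x)"
  shows "w \<in> side x y"
  using assms by (auto simp: side_def intro: rtrancl_into_rtrancl)

text \<open>
  Every edge of a tree is a bridge: a second connection from \<open>x\<close> to \<open>y\<close>, made simple and closed by
  the arc from \<open>y\<close> back to \<open>x\<close>, would be an undirected cycle.
\<close>

lemma other_end_not_in_side:
  assumes "dominates T x y"
  shows "y \<notin> side x y"
proof
  assume "y \<in> side x y"
  then have "(x, y) \<in> (arcs_ends T - {(x, y), (y, x)})\<^sup>*"
    by (simp add: side_def)
  moreover have "\<exists>p. awalk x p z \<and> (\<forall>e\<in>set p. arc_to_ends T e \<noteq> (x, y))"
    if "(x, z) \<in> (arcs_ends T - {(x, y), (y, x)})\<^sup>*" for z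
    using that
  proof (induction rule: rtrancl_induct)
    case base
    show ?case
      using adj_in_verts(1)[OF assms] by (intro exI[of _ "[]"]) (simp add: awalk_Nil_iff)
  next
    case (step v w)
    from step.IH obtain p where p: "awalk x p v" "\<forall>e\<in>set p. arc_to_ends T e \<noteq> (x, y)"
      by (elim exE conjE)
    from step.hyps have "dominates T v w" by simp
    then obtain e where e: "e \<in> arcs T" "tail T e = v" "head T e = w" by (rule reachableE)
    have "awalk x (p @ [e]) w"
      using p(1) arc_implies_awalk[OF e(1)] e by (intro awalk_appendI[of _ _ v]) simp_all
    moreover have "\<forall>e'\<in>set (p @ [e]). arc_to_ends T e' \<noteq> (x, y)"
      using p(2) step.hyps(2) e by (simp add: arc_to_ends_def)
    ultimately show ?case by (intro exI[of _ "p @ [e]"] conjI)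
  qed
  ultimately have "\<exists>p. awalk x p y \<and> (\<forall>e\<in>set p. arc_to_ends T e \<noteq> (x, y))"
    by simp
  then obtain p0 where p0: "awalk x p0 y" "\<forall>e\<in>set p0. arc_to_ends T e \<noteq> (x, y)"
    by (elim exE conjE)
  define p where "p = awalk_to_apath p0"
  have p: "apath x p y" "\<forall>e\<in>set p. arc_to_ends T e \<noteq> (x, y)"
    using apath_awalk_to_apath[OF p0(1)] awalk_to_apath_subset[OF p0(1)] p0(2)
    unfolding p_def by auto
  have "x \<noteq> y" using assms adj_not_same[of x] by metis
  \<comment> \<open>A path of length 1 would be the deleted arc itself, so the closed walk has length at least 3.\<close>
  have "2 \<le> length p"
  proof (cases p)
    case Nil
    then show ?thesis using p(1) \<open>x \<noteq> y\<close> by (simp add: apath_Nil_iff)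
  next
    case (Cons e q)
    then have "q \<noteq> []"
      using p by (cases q) (simp_all add: apath_Cons_iff apath_Nil_iff arc_to_ends_def)
    then show ?thesis using Cons by (cases q) simp_all
  qed
  obtain e where e: "e \<in> arcs T" "tail T e = y" "head T e = x"
    using dominates_sym[OF assms] by (rule reachableE)
  have "awalk y (e # p) y" and "distinct (tl (awalk_verts y (e # p)))"
    using p(1) e by (simp_all add: apath_def awalk_Cons_iff)
  then have "cycle (e # p)" unfolding cycle_def by (intro exI[of _ y]) simp
  moreover have "3 \<le> length (e # p)"
    using \<open>2 \<le> length p\<close> by simp
  ultimately show False
    using no_undirected_cycle by (elim notE) (intro exI[of _ "e # p"] conjI)
qed

text \<open>
  A walk that misses one endpoint of the edge cannot traverse the edge, hence stays on one side.
\<close>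

lemma walk_avoiding_end_in_side:
  assumes "awalk u p v" "z \<notin> set (awalk_verts u p)" "z = x \<or> z = y"
  shows "u \<in> side x y \<longleftrightarrow> v \<in> side x y"
  using assms
proof (induction p arbitrary: u)
  case Nil
  then show ?case by (simp add: awalk_Nil_iff)
next
  case (Cons e p)
  then have e: "e \<in> arcs T" "tail T e = u" and p: "awalk (head T e) p v"
    by (auto simp: awalk_Cons_iff)
  have uw: "dominates T u (head T e)"
    using in_arcs_imp_in_arcs_ends[OF e(1)] e(2) by simp
  have "z \<noteq> u" "z \<notin> set (awalk_verts (head T e) p)"
    using Cons.prems e by auto
  moreover from this(2) have "z \<noteq> head T e"
    using hd_in_awalk_verts(1)[OF p] by auto
  ultimately have "u \<in> side x y \<longleftrightarrow> head T e \<in> side x y"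
    using side_step[of u x y "head T e"] side_step[of "head T e" x y u] uw dominates_sym[OF uw]
      Cons.prems(3) by auto
  also have "\<dots> \<longleftrightarrow> v \<in> side x y"
    by (rule Cons.IH) fact+
  finally show ?case .
qed

text \<open>
  When a simple path crosses the edge \<open>x \<rightarrow> y\<close> and later \<open>x' \<rightarrow> y'\<close>, its segment from \<open>y\<close> to \<open>x'\<close>
  avoids \<open>x\<close> and \<open>y'\<close>. Hence \<open>x\<close> and \<open>y\<close> lie behind the second edge, while \<open>x'\<close> lies beyond the first
  one. A walk on the near side of the first edge therefore never meets \<open>x'\<close>, so it never uses the
  second edge, and all that it reaches lies behind the second edge too.
\<close>

lemma side_mono_along_path:
  assumes "apath a (p @ e # q @ e' # q') c"
  shows "side (tail T e) (head T e) \<subseteq> side (tail T e') (head T e')"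
proof
  let ?x = "tail T e" and ?y = "head T e" and ?x' = "tail T e'" and ?y' = "head T e'"
  have path: "apath ?x (e # q @ e' # q') c"
    using assms by (auto simp: apath_append_iff apath_Cons_iff)
  then have "apath ?y (q @ e' # q') c" and x: "?x \<notin> set (awalk_verts ?y (q @ e' # q'))"
    and "e \<in> arcs T"
    by (auto simp: apath_Cons_iff)
  from \<open>apath ?y (q @ e' # q') c\<close> have *: "apath ?y q ?x'" "e' \<in> arcs T" "apath ?y' q' c"
    "set (awalk_verts ?y q) \<inter> set (awalk_verts ?y' q') = {}"
    unfolding apath_append_iff by (simp_all add: apath_Cons_iff)
  then have q: "awalk ?y q ?x'" and e': "e' \<in> arcs T" and q': "awalk ?y' q' c"
    and disj: "set (awalk_verts ?y q) \<inter> set (awalk_verts ?y' q') = {}"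
    by (simp_all add: apath_def)
  have yx: "?x \<notin> set (awalk_verts ?y q)"
    using x set_awalk_verts_append[OF q, of "e' # q'" c] q' e' by (auto simp: awalk_Cons_iff)
  have y': "?y' \<notin> set (awalk_verts ?y q)"
    using disj hd_in_awalk_verts(1)[OF q'] by auto
  have "?y' \<in> set (awalk_verts ?y (q @ e' # q'))"
    using set_awalk_verts_append[OF q, of "e' # q'" c] q' e' hd_in_awalk_verts(1)[OF q']
    by (auto simp: awalk_Cons_iff)
  then have "?y' \<noteq> ?x" using x by auto
  have e: "dominates T ?x ?y"
    by (rule in_arcs_imp_in_arcs_ends) fact
  have "?y \<in> side ?x' ?y'"
    using walk_avoiding_end_in_side[OF q y'] self_in_side by auto
  moreover have "?y \<noteq> ?y'"
    using y' hd_in_awalk_verts(1)[OF q] by auto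
  ultimately have x_side: "?x \<in> side ?x' ?y'"
    using side_step[of ?y ?x' ?y' ?x] dominates_sym[OF e] \<open>?y' \<noteq> ?x\<close> by auto
  have "?x' \<notin> side ?x ?y"
    using other_end_not_in_side[OF e] walk_avoiding_end_in_side[OF q yx] by auto
  fix v
  assume "v \<in> side ?x ?y"
  then have "(?x, v) \<in> (arcs_ends T - {(?x, ?y), (?y, ?x)})\<^sup>*"
    by (simp add: side_def)
  then show "v \<in> side ?x' ?y'"
  proof (induction rule: rtrancl_induct)
    case base
    show ?case by (rule x_side)
  next
    case (step v w)
    have "v \<in> side ?x ?y" "w \<in> side ?x ?y"
      using step.hyps by (auto simp: side_def intro: rtrancl_into_rtrancl)
    then have "v \<noteq> ?x'" "w \<noteq> ?x'"
      using \<open>?x' \<notin> side ?x ?y\<close> by auto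
    then show ?case
      using side_step[OF step.IH] step.hyps by auto
  qed
qed

text \<open>
  Adding up the conservation laws over one side of an edge cancels every flow inside that side by
  antisymmetry. The edge itself is the only one that leaves the side.
\<close>

lemma flow_equals_injection_of_side:
  fixes f :: "'v \<Rightarrow> 'v \<Rightarrow> real" and P :: "'v \<Rightarrow> real"
  assumes antisym: "\<And>a b. dominates T a b \<Longrightarrow> f b a = - f a b"
    and conservation: "\<And>a. a \<in> verts T \<Longrightarrow> P a = (\<Sum>b | dominates T a b. f a b)"
    and xy: "dominates T x y"
  shows "f x y = (\<Sum>v\<in>side x y. P v)"
proof -
  let ?C = "side x y" and ?f = "\<lambda>(v, w). f v w"
  define inner where "inner = {(v, w) \<in> arcs_ends T. v \<in> ?C \<and> w \<in> ?C}"
  have C: "?C \<subseteq> verts T"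
    using adj_in_verts(1)[OF xy] by (rule side_subset_verts)
  have fin: "finite ?C" "finite (arcs_ends T)"
    using finite_subset[OF C] by (simp_all add: arcs_ends_def)
  then have fin_inner: "finite inner"
    by (auto simp: inner_def intro: finite_subset)
  have nbrs: "finite {w. dominates T v w}" for v
    by (rule finite_subset[of _ "verts T"]) (auto dest: adj_in_verts)
  have cut: "(SIGMA v:?C. {w. dominates T v w}) = insert (x, y) inner"
  proof (intro equalityI subsetI)
    fix z assume "z \<in> (SIGMA v:?C. {w. dominates T v w})"
    then obtain v w where z: "z = (v, w)" "v \<in> ?C" "dominates T v w" by auto
    moreover have "(v, w) \<noteq> (y, x)"
      using z other_end_not_in_side[OF xy] by auto
    ultimately show "z \<in> insert (x, y) inner"
      using side_step[of v x y w] by (auto simp: inner_def)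
  next
    fix z assume "z \<in> insert (x, y) inner"
    then show "z \<in> (SIGMA v:?C. {w. dominates T v w})"
      using xy self_in_side by (auto simp: inner_def)
  qed
  have "sum ?f inner = (\<Sum>(v, w)\<in>inner. f w v)"
    by (rule sum.reindex_bij_witness[where i = prod.swap and j = prod.swap])
      (auto simp: inner_def dominates_sym)
  also have "\<dots> = - sum ?f inner"
    unfolding sum_negf[symmetric] by (rule sum.cong) (auto simp: inner_def antisym)
  finally have inner: "sum ?f inner = 0" by simp
  have "(\<Sum>v\<in>?C. P v) = (\<Sum>v\<in>?C. \<Sum>w | dominates T v w. f v w)"
    using C conservation by (intro sum.cong) auto
  also have "\<dots> = sum ?f (SIGMA v:?C. {w. dominates T v w})"
    using fin nbrs by (subst sum.Sigma) auto
  also have "\<dots> = f x y"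
    unfolding cut using other_end_not_in_side[OF xy] fin_inner inner
    by (subst sum.insert) (auto simp: inner_def)
  finally show ?thesis by simp
qed

text \<open>
  A simple path from \<open>x\<close> to the root either visits \<open>y\<close>, or stays simple when the arc from \<open>y\<close> to \<open>x\<close> is
  put in front of it.
\<close>

lemma parent_cases:
  assumes "dominates T x y"
  shows "is_parent y x \<or> is_parent x y"
proof -
  have "x \<in> verts T" using adj_in_verts(1)[OF assms] .
  then have "x \<rightarrow>\<^sup>*\<^bsub>mk_symmetric T\<^esub> r"
    using connected_T reference_node
    unfolding Digraph_Component.connected_def strongly_connected_def
    by (simp add: mk_symmetric_def)
  then obtain p where p: "apath x p r"
    using reachable_mk_symmetric_eq[OF sym_arcs] reachable_apath by blast
  show ?thesis
  proof (cases "y \<in> set (awalk_verts x p)")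
    case True
    then show ?thesis using p assms by (auto simp: is_parent_def path_through_def)
  next
    case False
    obtain e where e: "e \<in> arcs T" "tail T e = y" "head T e = x"
      using dominates_sym[OF assms] by blast
    have "apath y (e # p) r"
      using p e False by (simp add: apath_Cons_iff)
    moreover have "x \<in> set (awalk_verts y (e # p))"
      using e hd_in_awalk_verts(2)[OF p] by simp
    ultimately show ?thesis
      using dominates_sym[OF assms] by (auto simp: is_parent_def path_through_def)
  qed
qed

end

section \<open>Variances of potential differences\<close>

context radial_flow_network
begin

abbreviation potential_diff :: "'v \<Rightarrow> 'v \<Rightarrow> 'w \<Rightarrow> real" where
  "potential_diff x y \<equiv> \<lambda>\<omega>. \<pi> x \<omega> - \<pi> y \<omega>"

lemma square_integrable_potential_diff:
  assumes "x \<in> verts T" "y \<in> verts T"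
  shows "square_integrable (potential_diff x y)"
  using assms
  by (intro square_integrable_diff)
    (blast intro: square_integrable_finite_variance[OF potential_integrable potential_finite_variance])+

text \<open>
  For an arc directed away from the root the flow function \<open>g y x\<close> belongs to the opposite arc; its
  reflection \<open>t \<mapsto> - g y x (- t)\<close> is again increasing. Thus arcs in both directions can be treated
  alike.
\<close>

lemma potential_diff_is_increasing_in_flow:
  assumes "dominates T x y"
  shows "\<exists>h. strict_mono h \<and> (\<forall>\<omega>\<in>space M. potential_diff x y \<omega> = h (f x y \<omega>))"
proof (cases "is_parent y x")
  case True
  then show ?thesis
    using flow_function_strict_mono potential_difference by blast
next
  case False
  then have parent: "is_parent x y" using parent_cases[OF assms] by blast
  have "strict_mono (\<lambda>t. - g y x (- t))"
    using flow_function_strict_mono[OF parent] by (simp add: strict_mono_def)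
  moreover have "potential_diff x y \<omega> = - g y x (- f x y \<omega>)" if "\<omega> \<in> space M" for \<omega>
    using potential_difference[OF parent that] flow_antisym[OF assms that] by simp
  ultimately show ?thesis by (intro exI[of _ "\<lambda>t. - g y x (- t)"]) simp
qed

lemma total_injection_zero:
  "\<omega> \<in> space M \<Longrightarrow> (\<Sum>v\<in>verts T. P v \<omega>) = 0"
  using reference_injection reference_node by (simp add: sum.remove)

text \<open>
  The injection at the root depends on all the others. Whichever side contains the root, one of the
  two formulas involves independent injections only.
\<close>

lemma flow_eq_sum_injections:
  assumes "dominates T x y" "\<omega> \<in> space M"
  shows "f x y \<omega> = (\<Sum>v\<in>side x y. P v \<omega>)"
    and "f x y \<omega> = - (\<Sum>v\<in>verts T - side x y. P v \<omega>)"
proof -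
  show *: "f x y \<omega> = (\<Sum>v\<in>side x y. P v \<omega>)"
    using assms flow_antisym flow_conservation
    by (intro flow_equals_injection_of_side[where f = "\<lambda>u v. f u v \<omega>"]) auto
  show "f x y \<omega> = - (\<Sum>v\<in>verts T - side x y. P v \<omega>)"
    using total_injection_zero[OF assms(2)] side_subset_verts[OF adj_in_verts(1)[OF assms(1)]]
    by (simp add: * sum_diff)
qed

text \<open>
  The flow on an edge is, up to a sign, the sum of the injections on the side that does not contain
  the root. The position of the root relative to the nested sides decides how the two flows share
  injections: if it lies outside both sides or inside both, one flow is the other one plus an
  independent term; if it lies between them, the flows are independent.
\<close>

lemma covariance_potential_diff_nonneg_if_nested:
  assumes xy: "dominates T x y" and uv: "dominates T u v" and nested: "side x y \<subseteq> side u v"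
  shows "0 \<le> covariance (potential_diff x y) (potential_diff u v)"
proof -
  obtain h where h: "strict_mono h" "\<And>\<omega>. \<omega> \<in> space M \<Longrightarrow> potential_diff x y \<omega> = h (f x y \<omega>)"
    using potential_diff_is_increasing_in_flow[OF xy] by auto
  obtain k where k: "strict_mono k" "\<And>\<omega>. \<omega> \<in> space M \<Longrightarrow> potential_diff u v \<omega> = k (f u v \<omega>)"
    using potential_diff_is_increasing_in_flow[OF uv] by auto
  note mono = strict_mono_mono[OF h(1)] strict_mono_mono[OF k(1)]
  note [measurable] = mono[THEN borel_measurable_mono]
  note sq = square_integrable_potential_diff[OF adj_in_verts[OF xy]]
    square_integrable_potential_diff[OF adj_in_verts[OF uv]]
  note sub = side_subset_verts[OF adj_in_verts(1)[OF xy], of y]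
    side_subset_verts[OF adj_in_verts(1)[OF uv], of v]
  have fin: "finite (side x y)" "finite (side u v)"
    using finite_subset[OF sub(1)] finite_subset[OF sub(2)] by simp_all
  define S where "S A \<omega> = (\<Sum>i\<in>A. P i \<omega>)" for A \<omega>
  have S_indep: "indep_var borel (S A) borel (S B)"
    if "A \<inter> B = {}" "A \<subseteq> verts T - {r}" "B \<subseteq> verts T - {r}" for A B
    using indep_var_sums[OF injections_indep that] by (simp add: S_def[abs_def])
  note flow = flow_eq_sum_injections[OF xy, folded S_def] flow_eq_sum_injections[OF uv, folded S_def]
  have nonneg: "0 \<le> covariance (potential_diff a b) (potential_diff a' b')"
    if indep: "indep_var borel X borel R" and "mono H" "\<And>\<rho>. mono (\<lambda>t. K t \<rho>)"
      "case_prod K \<in> borel_measurable (borel \<Otimes>\<^sub>M borel)"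
      and eq: "\<And>\<omega>. \<omega> \<in> space M \<Longrightarrow> potential_diff a b \<omega> = H (X \<omega>)"
        "\<And>\<omega>. \<omega> \<in> space M \<Longrightarrow> potential_diff a' b' \<omega> = K (X \<omega>) (R \<omega>)"
      and sq: "square_integrable (potential_diff a b)" "square_integrable (potential_diff a' b')"
    for a b a' b' H K and X R :: "'w \<Rightarrow> real"
  proof -
    have sq_H: "square_integrable (\<lambda>\<omega>. H (X \<omega>))"
      by (rule iffD1[OF square_integrable_cong sq(1)]) (fact eq)
    have sq_K: "square_integrable (\<lambda>\<omega>. K (X \<omega>) (R \<omega>))"
      by (rule iffD1[OF square_integrable_cong sq(2)]) (fact eq)
    have "covariance (potential_diff a b) (potential_diff a' b')
        = covariance (\<lambda>\<omega>. H (X \<omega>)) (\<lambda>\<omega>. K (X \<omega>) (R \<omega>))"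
      by (rule covariance_cong) (fact eq)+
    also have "0 \<le> \<dots>"
      by (rule covariance_nonneg_common_variable[where X = X and R = R and h = H and k = K])
        (fact that sq_H sq_K)+
    finally show ?thesis .
  qed
  have mono_shift: "mono (\<lambda>t. h (t + \<rho>))" "mono (\<lambda>t. k (t + \<rho>))" for \<rho>
    using mono by (auto simp: mono_def)
  have shift: "case_prod (\<lambda>t \<rho>. h (t + \<rho>)) \<in> borel_measurable (borel \<Otimes>\<^sub>M borel)"
    "case_prod (\<lambda>t \<rho>. k (t + \<rho>)) \<in> borel_measurable (borel \<Otimes>\<^sub>M borel)"
    "case_prod (\<lambda>(t::real) \<rho>. k (- \<rho>)) \<in> borel_measurable (borel \<Otimes>\<^sub>M borel)"
    by measurable
  consider "r \<notin> side u v" | "r \<in> side x y" | "r \<in> side u v" "r \<notin> side x y" by blast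
  then show ?thesis
  proof cases
    case 1
    let ?A = "side x y" and ?B = "side u v - side x y"
    have split: "S (side u v) \<omega> = S ?A \<omega> + S ?B \<omega>" for \<omega>
      unfolding S_def using sum.subset_diff[OF nested fin(2)] by (simp add: add.commute)
    have indep: "indep_var borel (S ?A) borel (S ?B)"
      using 1 nested sub by (intro S_indep) auto
    show ?thesis
    proof (rule nonneg[OF indep mono(1) _ shift(2) _ _ sq])
      fix \<omega> assume \<omega>: "\<omega> \<in> space M"
      show "potential_diff x y \<omega> = h (S ?A \<omega>)"
        using h(2)[OF \<omega>] flow(1)[OF \<omega>] by simp
      show "potential_diff u v \<omega> = k (S ?A \<omega> + S ?B \<omega>)"
        using k(2)[OF \<omega>] flow(3)[OF \<omega>] split by simp
    qed (rule mono_shift)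
  next
    case 2
    let ?A = "verts T - side u v" and ?B = "side u v - side x y"
    have split: "S (verts T - side x y) \<omega> = S ?A \<omega> + S ?B \<omega>" for \<omega>
    proof -
      have "verts T - side x y = ?A \<union> ?B" using sub nested by auto
      moreover have "sum g (?A \<union> ?B) = sum g ?A + sum g ?B" for g :: "'v \<Rightarrow> real"
        using fin by (intro sum.union_disjoint) auto
      ultimately show ?thesis unfolding S_def by simp
    qed
    have "indep_var borel (S ?A) borel (S ?B)"
      using 2 nested sub by (intro S_indep) auto
    from indep_var_compose[OF this, of uminus borel uminus borel]
    have indep: "indep_var borel (\<lambda>\<omega>. - S ?A \<omega>) borel (\<lambda>\<omega>. - S ?B \<omega>)"
      by (simp add: comp_def)
    \<comment> \<open>The complements are nested in the reverse order, so the roles of the two arcs are exchanged.\<close>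
    have "0 \<le> covariance (potential_diff u v) (potential_diff x y)"
    proof (rule nonneg[OF indep mono(2) _ shift(1) _ _ sq(2,1)])
      fix \<omega> assume \<omega>: "\<omega> \<in> space M"
      show "potential_diff u v \<omega> = k (- S ?A \<omega>)"
        using k(2)[OF \<omega>] flow(4)[OF \<omega>] by simp
      show "potential_diff x y \<omega> = h (- S ?A \<omega> + - S ?B \<omega>)"
        using h(2)[OF \<omega>] flow(2)[OF \<omega>] split by simp
    qed (rule mono_shift)
    then show ?thesis by (simp add: covariance_commute)
  next
    case 3
    let ?A = "side x y" and ?B = "verts T - side u v"
    \<comment> \<open>The complement of the outer side is disjoint from the inner side.\<close>
    have indep: "indep_var borel (S ?A) borel (S ?B)"
      using 3 nested sub by (intro S_indep) auto
    show ?thesis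
    proof (rule nonneg[OF indep mono(1) _ shift(3) _ _ sq])
      fix \<omega> assume \<omega>: "\<omega> \<in> space M"
      show "potential_diff x y \<omega> = h (S ?A \<omega>)"
        using h(2)[OF \<omega>] flow(1)[OF \<omega>] by simp
      show "potential_diff u v \<omega> = k (- S ?B \<omega>)"
        using k(2)[OF \<omega>] flow(4)[OF \<omega>] by simp
    qed (simp add: mono_def)
  qed
qed

text \<open>
  The flow is, up to sign, a nonempty sum of independent injections, so it has a density.
\<close>

lemma variance_potential_diff_pos_if_adjacent:
  assumes xy: "dominates T x y"
  shows "0 < variance (potential_diff x y)"
proof -
  obtain h where h: "strict_mono h" "\<And>\<omega>. \<omega> \<in> space M \<Longrightarrow> potential_diff x y \<omega> = h (f x y \<omega>)"
    using potential_diff_is_increasing_in_flow[OF xy] by auto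
  obtain A H where A: "A \<subseteq> verts T - {r}" "A \<noteq> {}" and H: "inj H"
    and diff: "\<And>\<omega>. \<omega> \<in> space M \<Longrightarrow> potential_diff x y \<omega> = H (\<Sum>i\<in>A. P i \<omega>)"
  proof (cases "r \<in> side x y")
    case True
    have "inj (\<lambda>t. h (- t))"
      using strict_mono_eq[OF h(1)] by (simp add: inj_def)
    moreover have "y \<in> verts T - side x y"
      using adj_in_verts(2)[OF xy] other_end_not_in_side[OF xy] by simp
    ultimately show ?thesis
      using that[of "verts T - side x y" "\<lambda>t. h (- t)"] True h(2) flow_eq_sum_injections(2)[OF xy]
      by auto
  next
    case False
    have "side x y \<subseteq> verts T - {r}"
      using side_subset_verts[OF adj_in_verts(1)[OF xy], of y] False by auto
    moreover have "side x y \<noteq> {}" using self_in_side by blast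
    ultimately show ?thesis
      using strict_mono_imp_inj_on[OF h(1), of UNIV] h(2) flow_eq_sum_injections(1)[OF xy]
      by (intro that[of "side x y" h]) simp_all
  qed
  have "finite A" using A finite_subset[of A "verts T"] by auto
  then obtain D where D: "distributed M lborel (\<lambda>\<omega>. \<Sum>i\<in>A. P i \<omega>) D"
    using sum_has_density[OF _ A(2) indep_vars_subset[OF injections_indep A(1)]]
      injections_density A(1) by blast
  have "square_integrable (\<lambda>\<omega>. H (\<Sum>i\<in>A. P i \<omega>))"
    by (rule iffD1[OF square_integrable_cong square_integrable_potential_diff[OF adj_in_verts[OF xy]]])
      (fact diff)
  from variance_pos_if_injective_image_of_density[OF this H D]
  show ?thesis
    by (simp add: diff cong: Bochner_Integration.integral_cong)
qed

text \<open>
  Potential differences telescope along a walk, and covariance is additive in its first argument.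
\<close>

lemma covariance_potential_diff_walk_nonneg:
  assumes "awalk u p v" "square_integrable Z"
    and "\<And>e. e \<in> set p \<Longrightarrow> 0 \<le> covariance (potential_diff (tail T e) (head T e)) Z"
  shows "0 \<le> covariance (potential_diff u v) Z"
  using assms
proof (induction p arbitrary: u)
  case Nil
  then show ?case by (simp add: awalk_Nil_iff covariance_def)
next
  case (Cons e p)
  then have e: "e \<in> arcs T" "tail T e = u" and p: "awalk (head T e) p v"
    by (auto simp: awalk_Cons_iff)
  have "covariance (potential_diff u v) Z
      = covariance (\<lambda>\<omega>. potential_diff u (head T e) \<omega> + potential_diff (head T e) v \<omega>) Z"
    by simp
  also have "\<dots>
      = covariance (potential_diff u (head T e)) Z + covariance (potential_diff (head T e) v) Z"
    using e p Cons.prems(2)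
    by (intro covariance_add_left square_integrable_potential_diff) auto
  also have "0 \<le> \<dots>"
    using Cons.IH[OF p] Cons.prems(2,3) e by (auto intro!: add_nonneg_nonneg)
  finally show ?case .
qed

text \<open>
  Each arc of the first piece precedes each arc of the second one on a simple path, so the sides of
  the two arcs are nested.
\<close>

lemma covariance_potential_diff_consecutive_nonneg:
  assumes path: "apath u (p @ q) w" and p: "awalk u p v" and q: "awalk v q w"
  shows "0 \<le> covariance (potential_diff u v) (potential_diff v w)"
proof (rule covariance_potential_diff_walk_nonneg[OF p])
  show "square_integrable (potential_diff v w)"
    using q by (intro square_integrable_potential_diff) auto
  fix e assume e: "e \<in> set p"
  then have arc: "e \<in> arcs T" using p by auto
  have "0 \<le> covariance (potential_diff v w) (potential_diff (tail T e) (head T e))"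
  proof (rule covariance_potential_diff_walk_nonneg[OF q])
    show "square_integrable (potential_diff (tail T e) (head T e))"
      using arc by (intro square_integrable_potential_diff) simp_all
    fix e' assume e': "e' \<in> set q"
    from e obtain p1 p2 where "p = p1 @ e # p2" by (meson split_list)
    moreover from e' obtain q1 q2 where "q = q1 @ e' # q2" by (meson split_list)
    ultimately have "apath u (p1 @ e # (p2 @ q1) @ e' # q2) w" using path by simp
    then have "side (tail T e) (head T e) \<subseteq> side (tail T e') (head T e')"
      by (rule side_mono_along_path)
    moreover have "e' \<in> arcs T" using e' q by auto
    ultimately
    have "0 \<le> covariance (potential_diff (tail T e) (head T e))
        (potential_diff (tail T e') (head T e'))"
      using arc by (intro covariance_potential_diff_nonneg_if_nested in_arcs_imp_in_arcs_ends)
    then show "0 \<le> covariance (potential_diff (tail T e') (head T e'))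
        (potential_diff (tail T e) (head T e))"
      by (simp add: covariance_commute)
  qed
  then show "0 \<le> covariance (potential_diff (tail T e) (head T e)) (potential_diff v w)"
    by (simp add: covariance_commute)
qed

lemma variance_potential_diff_superadditive:
  assumes path: "apath u (p @ q) w" and p: "awalk u p v" and q: "awalk v q w"
  shows "variance (potential_diff u v) + variance (potential_diff v w) \<le> variance (potential_diff u w)"
proof -
  have verts: "u \<in> verts T" "v \<in> verts T" "w \<in> verts T" using p q by auto
  have "variance (potential_diff u w) = variance (\<lambda>\<omega>. potential_diff u v \<omega> + potential_diff v w \<omega>)"
    by simp
  also have "\<dots>
      = variance (potential_diff u v) + variance (potential_diff v w)
        + 2 * covariance (potential_diff u v) (potential_diff v w)"
    using verts by (intro variance_add square_integrable_potential_diff)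
  finally show ?thesis
    using covariance_potential_diff_consecutive_nonneg[OF assms] by simp
qed

text \<open>
  By superadditivity the variance is at least that of the potential difference across the first arc.
\<close>

lemma variance_potential_diff_pos:
  assumes path: "apath u p w" and "u \<noteq> w"
  shows "0 < variance (potential_diff u w)"
proof (cases p)
  case Nil
  then show ?thesis using assms by (simp add: apath_Nil_iff)
next
  case (Cons e q)
  then have e: "e \<in> arcs T" "tail T e = u" and q: "awalk (head T e) q w"
    using path by (auto simp: apath_Cons_iff intro: awalkI_apath)
  have "0 < variance (potential_diff u (head T e))"
    using in_arcs_imp_in_arcs_ends[OF e(1)] e(2) by (intro variance_potential_diff_pos_if_adjacent) simp
  also have "\<dots> \<le> variance (potential_diff u (head T e)) + variance (potential_diff (head T e) w)"
    using variance_positive by simp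
  also have "\<dots> \<le> variance (potential_diff u w)"
    using path Cons arc_implies_awalk[OF e(1)] e(2) q
    by (intro variance_potential_diff_superadditive[where p = "[e]" and q = q]) simp_all
  finally show ?thesis .
qed

end

theorem theorem2:
  fixes T :: "('v, 'e) pre_digraph" and r :: 'v and M :: "'w measure"
    and P :: "'v \<Rightarrow> 'w \<Rightarrow> real" and f :: "'v \<Rightarrow> 'v \<Rightarrow> 'w \<Rightarrow> real"
    and g :: "'v \<Rightarrow> 'v \<Rightarrow> real \<Rightarrow> real" and \<pi> :: "'v \<Rightarrow> 'w \<Rightarrow> real"
    and a b c :: 'v
  assumes "radial_flow_network T r M P f g \<pi>"
    and "a \<in> verts T" and "b \<in> verts T" and "c \<in> verts T"
    and "a \<noteq> b" and "b \<noteq> c" and "a \<noteq> c"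
    and "pre_digraph.path_through T a b c"
  shows "potential_diff_variance M \<pi> a b < potential_diff_variance M \<pi> a c"
proof -
  interpret radial_flow_network T r M P f g \<pi> by fact
  obtain p where p: "apath a p c" "b \<in> set (awalk_verts a p)"
    using assms(8) unfolding path_through_def by blast
  then obtain q s where qs: "p = q @ s" "awalk a q b" "awalk b s c"
    using awalk_decomp[OF awalkI_apath[OF p(1)] p(2)] by blast
  have "apath b s c"
    using p(1) qs by (auto simp: apath_append_iff)
  then have "0 < variance (potential_diff b c)"
    using assms(6) by (rule variance_potential_diff_pos)
  also have "variance (potential_diff b c) \<le> variance (potential_diff a c) - variance (potential_diff a b)"
    using variance_potential_diff_superadditive[of a q s c b] p(1) qs by simp
  finally show ?thesis
    by (simp add: potential_diff_variance_def)
qed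

end
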